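(* $R(K_3, K_4, C_4, C_4) \ge 49$. Equivalently, there exists a $4$-coloring of the edges of $K_{48}$ with colors $1,2,3,4$ containing no triangle $K_3$ in color $1$, no $K_4$ in color $2$, no $4$-cycle $C_4$ in color $3$, and no $4$-cycle $C_4$ in color $4$ (a copy in color $i$ meaning a subgraph, not necessarily induced, all of whose edges have color $i$).
   Context: For graphs $G_1,\dots,G_k$, the multicolor Ramsey number $R(G_1,\dots,G_k)$ is the smallest $n$ such that every $k$-coloring of the edges of the complete graph $K_n$ (with colors $1,\dots,k$) contains, for some $i$, a copy of $G_i$ (as a not necessarily induced subgraph) all of whose edges have color $i$. $C_m$ denotes the cycle on $m$ vertices. *)

theory Defs
  imports "HOL-Library.Ramsey"
begin

type_synonym 'a graph = "'a set \<times> 'a set set"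

definition complete_graph :: "nat \<Rightarrow> nat graph" where
  "complete_graph n = ({..<n}, [{..<n}]\<^bsup>2\<^esup>)"

text \<open>A cycle only for \<open>m \<ge> 3\<close>.\<close>

definition cycle_graph :: "nat \<Rightarrow> nat graph" where
  "cycle_graph m = ({..<m}, {{i, Suc i mod m} |i. i < m})"

definition contains_copy :: "'b graph \<Rightarrow> 'a graph \<Rightarrow> bool" where
  "contains_copy H G \<longleftrightarrow>
    (\<exists>f. f \<in> fst G \<rightarrow> fst H \<and> inj_on f (fst G) \<and> (\<forall>e\<in>snd G. f ` e \<in> snd H))"

definition edge_coloring :: "nat \<Rightarrow> nat \<Rightarrow> (nat set \<Rightarrow> nat) \<Rightarrow> bool" where
  "edge_coloring k n c \<longleftrightarrow> c \<in> snd (complete_graph n) \<rightarrow> {1..k}"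

definition color_class :: "nat \<Rightarrow> (nat set \<Rightarrow> nat) \<Rightarrow> nat \<Rightarrow> nat graph" where
  "color_class n c i = (fst (complete_graph n), {e \<in> snd (complete_graph n). c e = i})"

text \<open>Colors are numbered from 1, list positions from 0. For finite simple graphs
  the minimum exists by Ramsey's theorem.\<close>

definition ramsey_number :: "'a graph list \<Rightarrow> nat" where
  "ramsey_number Gs = (LEAST n. \<forall>c. edge_coloring (length Gs) n c \<longrightarrow>
     (\<exists>i\<in>{1..length Gs}. contains_copy (color_class n c i) (Gs ! (i - 1))))"

end

theory Submission
  imports Defs "HOL-Library.Sublist"
begin

text \<open>
  The coloring was found by computer search among perturbed blow-ups. A triangle-free 4-regular
  graph \<open>H\<close> on 12 vertices, with independence number 4 but only 18 independent 4-sets, is blown up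
  by replacing each vertex by four; color 1 is exactly this blow-up. The pairs inside a part get
  colors 3 and 4, the remaining pairs mostly color 2, so a \<open>K\<^sub>4\<close> in color 2 would have
  to be a transversal of one of the 18 independent 4-sets; a few edges of colors 3 and 4 between
  nonadjacent parts destroy all of these without closing a 4-cycle.
  The coloring is invariant under a semiregular cyclic group of order 6 and is therefore
  given by circulant blocks.
\<close>

definition finite_simple_graph :: "'a graph \<Rightarrow> bool" where
  "finite_simple_graph G \<longleftrightarrow> finite (fst G) \<and> snd G \<subseteq> [fst G]\<^bsup>2\<^esup>"

lemma finite_simple_graph_complete_graph: "finite_simple_graph (complete_graph n)"
  by (simp add: finite_simple_graph_def complete_graph_def)

lemma finite_simple_graph_cycle_graph:
  assumes "m \<ge> 3"
  shows "finite_simple_graph (cycle_graph m)"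
  using assms by (auto simp: finite_simple_graph_def cycle_graph_def mod_Suc doubleton_eq_iff)

lemma contains_copy_subgraph:
  assumes "fst G \<subseteq> fst H" "snd G \<subseteq> snd H"
  shows "contains_copy H G"
  unfolding contains_copy_def using assms by (intro exI[of _ id]) auto

lemma contains_copy_trans:
  assumes "contains_copy K H" "contains_copy H G"
  shows "contains_copy K G"
proof -
  obtain f g where "f \<in> fst H \<rightarrow> fst K" "inj_on f (fst H)" "\<forall>e\<in>snd H. f ` e \<in> snd K"
    and "g \<in> fst G \<rightarrow> fst H" "inj_on g (fst G)" "\<forall>e\<in>snd G. g ` e \<in> snd H"
    using assms unfolding contains_copy_def by blast
  then have "f \<circ> g \<in> fst G \<rightarrow> fst K" "inj_on (f \<circ> g) (fst G)"
    "\<forall>e\<in>snd G. (f \<circ> g) ` e \<in> snd K"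
    by (auto simp flip: image_image intro!: comp_inj_on intro: inj_on_subset)
  then show ?thesis
    unfolding contains_copy_def by blast
qed

lemma complete_graph_contains_copy:
  assumes "finite_simple_graph G"
  shows "contains_copy (complete_graph (card (fst G))) G"
proof -
  obtain f where f: "bij_betw f (fst G) {..<card (fst G)}"
    using assms ex_bij_betw_finite_nat[of "fst G"]
    by (auto simp: finite_simple_graph_def atLeast0LessThan)
  then have "f ` e \<in> [{..<card (fst G)}]\<^bsup>2\<^esup>" if "e \<in> snd G" for e
    using that assms bij_betwE[OF bij_betw_nsets[OF f, of 2]]
    by (auto simp: finite_simple_graph_def)
  with f show ?thesis
    by (auto simp: contains_copy_def complete_graph_def bij_betw_def)
qed

lemma contains_copy_complete_graph_iff:
  "contains_copy H (complete_graph m) \<longleftrightarrow> (\<exists>S\<in>[fst H]\<^bsup>m\<^esup>. [S]\<^bsup>2\<^esup> \<subseteq> snd H)"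
proof
  assume "contains_copy H (complete_graph m)"
  then obtain f where f: "f \<in> {..<m} \<rightarrow> fst H" "inj_on f {..<m}"
    and edges: "\<forall>e\<in>[{..<m}]\<^bsup>2\<^esup>. f ` e \<in> snd H"
    by (auto simp: contains_copy_def complete_graph_def)
  have "[f ` {..<m}]\<^bsup>2\<^esup> = (`) f ` [{..<m}]\<^bsup>2\<^esup>"
    using bij_betw_nsets[OF inj_on_imp_bij_betw[OF f(2)]] by (simp add: bij_betw_def)
  moreover have "f ` {..<m} \<in> [fst H]\<^bsup>m\<^esup>"
    using f by (auto simp: nsets_def card_image)
  ultimately show "\<exists>S\<in>[fst H]\<^bsup>m\<^esup>. [S]\<^bsup>2\<^esup> \<subseteq> snd H"
    using edges by (intro bexI[of _ "f ` {..<m}"]) auto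
next
  assume "\<exists>S\<in>[fst H]\<^bsup>m\<^esup>. [S]\<^bsup>2\<^esup> \<subseteq> snd H"
  then obtain S where S: "S \<subseteq> fst H" "finite S" "card S = m" "[S]\<^bsup>2\<^esup> \<subseteq> snd H"
    by (auto simp: nsets_def)
  then have "contains_copy H (S, [S]\<^bsup>2\<^esup>)"
    by (intro contains_copy_subgraph) auto
  moreover obtain f where f: "bij_betw f {..<m} S"
    using ex_bij_betw_nat_finite[OF S(2)] S(3) by (auto simp: atLeast0LessThan)
  then have "contains_copy (S, [S]\<^bsup>2\<^esup>) (complete_graph m)"
    using bij_betwE[OF bij_betw_nsets[OF f, of 2]]
    by (auto simp: contains_copy_def complete_graph_def bij_betw_def)
  ultimately show "contains_copy H (complete_graph m)"
    by (rule contains_copy_trans)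
qed

lemma contains_copy_cycle_graph_4E:
  assumes "contains_copy H (cycle_graph 4)"
  obtains x y a b where "{x, y, a, b} \<subseteq> fst H" "x \<noteq> y" "a \<noteq> b"
    "{x, a} \<in> snd H" "{x, b} \<in> snd H" "{y, a} \<in> snd H" "{y, b} \<in> snd H"
proof -
  obtain f where f: "f \<in> {..<4} \<rightarrow> fst H" "inj_on f {..<4}"
    and edges: "\<forall>e\<in>{{j, Suc j mod 4} |j. j < 4}. f ` e \<in> snd H"
    using assms by (auto simp: contains_copy_def cycle_graph_def)
  have edge: "f ` {j, Suc j mod 4} \<in> snd H" if "j < 4" for j
    using edges that by blast
  show thesis
  proof
    show "{f 0, f 2, f 1, f 3} \<subseteq> fst H"
      using f(1) by auto
    show "f 0 \<noteq> f 2" "f 1 \<noteq> f 3"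
      using inj_onD[OF f(2), of 0 2] inj_onD[OF f(2), of 1 3] by auto
    show "{f 0, f 1} \<in> snd H" "{f 0, f 3} \<in> snd H" "{f 2, f 1} \<in> snd H" "{f 2, f 3} \<in> snd H"
      using edge[of 0] edge[of 1] edge[of 2] edge[of 3]
      by (simp_all add: insert_commute flip: numeral_2_eq_2)
  qed
qed

lemma contains_copy_color_class_complete_graph_iff:
  "contains_copy (color_class n c i) (complete_graph m) \<longleftrightarrow> monochromatic {..<n} m 2 c i"
proof -
  have "[S]\<^bsup>2\<^esup> \<subseteq> [{..<n}]\<^bsup>2\<^esup>" if "S \<in> [{..<n}]\<^bsup>m\<^esup>" for S
    using that by (intro nsets_mono) (simp add: nsets_def)
  then show ?thesis
    unfolding contains_copy_complete_graph_iff monochromatic_def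
    by (fastforce simp: color_class_def complete_graph_def)
qed

definition ramsey_coloring :: "'a graph list \<Rightarrow> nat \<Rightarrow> (nat set \<Rightarrow> nat) \<Rightarrow> bool" where
  "ramsey_coloring Gs n c \<longleftrightarrow> edge_coloring (length Gs) n c \<and>
     (\<forall>i<length Gs. \<not> contains_copy (color_class n c (Suc i)) (Gs ! i))"

lemma ramsey_number_eq_Least: "ramsey_number Gs = (LEAST n. \<nexists>c. ramsey_coloring Gs n c)"
proof -
  have "(\<exists>i\<in>{1..length Gs}. contains_copy (color_class n c i) (Gs ! (i - 1))) \<longleftrightarrow>
      (\<exists>i<length Gs. contains_copy (color_class n c (Suc i)) (Gs ! i))" for n c
    unfolding image_Suc_lessThan[symmetric] by auto
  then show ?thesis
    unfolding ramsey_number_def ramsey_coloring_def by simp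
qed

lemma ramsey_coloring_antimono:
  assumes "ramsey_coloring Gs N c" "n \<le> N"
  shows "ramsey_coloring Gs n c"
proof -
  have "[{..<n}]\<^bsup>2\<^esup> \<subseteq> [{..<N}]\<^bsup>2\<^esup>"
    using assms(2) by (intro nsets_mono) auto
  then have "edge_coloring k N c \<Longrightarrow> edge_coloring k n c"
    and "contains_copy (color_class N c i) (color_class n c i)" for k i
    using assms(2) by (auto simp: edge_coloring_def color_class_def complete_graph_def
      intro!: contains_copy_subgraph)
  then show ?thesis
    using assms(1) contains_copy_trans unfolding ramsey_coloring_def by blast
qed

lemma ex_no_ramsey_coloring:
  assumes simple: "\<And>G. G \<in> set Gs \<Longrightarrow> finite_simple_graph G"
  shows "\<exists>n. \<nexists>c. ramsey_coloring Gs n c"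
proof -
  let ?ms = "map (\<lambda>G. card (fst G)) Gs"
  obtain n :: nat where n: "partn_lst {..<n} ?ms 2"
    using ramsey_full by blast
  have "\<not> ramsey_coloring Gs n c" for c
  proof
    assume c: "ramsey_coloring Gs n c"
    then have range: "c e \<in> {1..length Gs}" if "e \<in> [{..<n}]\<^bsup>2\<^esup>" for e
      using that by (auto simp: ramsey_coloring_def edge_coloring_def complete_graph_def)
    then have "(\<lambda>e. c e - 1) \<in> [{..<n}]\<^bsup>2\<^esup> \<rightarrow> {..<length ?ms}"
      by fastforce
    then obtain i where i: "i < length Gs"
      and "monochromatic {..<n} (card (fst (Gs ! i))) 2 (\<lambda>e. c e - 1) i"
      using n by (auto simp: partn_lst_def)
    then obtain S where S: "S \<in> [{..<n}]\<^bsup>card (fst (Gs ! i))\<^esup>"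
      and mono: "\<And>e. e \<in> [S]\<^bsup>2\<^esup> \<Longrightarrow> c e - 1 = i"
      by (auto simp: monochromatic_def)
    have "c e = Suc i" if "e \<in> [S]\<^bsup>2\<^esup>" for e
    proof -
      have "[S]\<^bsup>2\<^esup> \<subseteq> [{..<n}]\<^bsup>2\<^esup>"
        using S by (intro nsets_mono) (simp add: nsets_def)
      then show ?thesis
        using range[of e] mono[OF that] that by auto
    qed
    then have "contains_copy (color_class n c (Suc i)) (complete_graph (card (fst (Gs ! i))))"
      using S by (auto simp: contains_copy_color_class_complete_graph_iff monochromatic_def)
    then have "contains_copy (color_class n c (Suc i)) (Gs ! i)"
      using contains_copy_trans complete_graph_contains_copy simple nth_mem[OF i] by blast
    then show False
      using c i by (auto simp: ramsey_coloring_def)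
  qed
  then show ?thesis
    by blast
qed

lemma less_ramsey_number_iff:
  assumes "\<And>G. G \<in> set Gs \<Longrightarrow> finite_simple_graph G"
  shows "N < ramsey_number Gs \<longleftrightarrow> (\<exists>c. ramsey_coloring Gs N c)"
proof
  assume "N < ramsey_number Gs"
  then show "\<exists>c. ramsey_coloring Gs N c"
    unfolding ramsey_number_eq_Least using not_less_Least by blast
next
  assume "\<exists>c. ramsey_coloring Gs N c"
  moreover have "\<nexists>c. ramsey_coloring Gs (ramsey_number Gs) c"
    unfolding ramsey_number_eq_Least by (rule LeastI_ex[OF ex_no_ramsey_coloring[OF assms]])
  ultimately show "N < ramsey_number Gs"
    by (meson not_le ramsey_coloring_antimono)
qed

fun clique_free :: "('a \<Rightarrow> 'a \<Rightarrow> bool) \<Rightarrow> nat \<Rightarrow> 'a list \<Rightarrow> bool" where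
  "clique_free R 0 xs = False"
| "clique_free R (Suc k) [] = True"
| "clique_free R (Suc k) (x # xs) =
     (clique_free R k (filter (R x) xs) \<and> clique_free R (Suc k) xs)"

lemma clique_free_imp_length_neq:
  assumes "clique_free R k xs" "subseq ys xs" "sorted_wrt R ys"
  shows "length ys \<noteq> k"
  using assms
proof (induction R k xs arbitrary: ys rule: clique_free.induct)
  case (3 R k x xs)
  show ?case
  proof (cases "subseq ys xs")
    case True
    then show ?thesis
      using "3.IH"(2) "3.prems" by simp
  next
    case False
    then obtain zs where ys: "ys = x # zs" "subseq zs xs"
      using "3.prems"(2) by (cases ys) (auto split: if_splits)
    then have "filter (R x) zs = zs" "sorted_wrt R zs"
      using "3.prems"(3) by (auto simp: filter_id_conv)
    then have "length zs \<noteq> k"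
      using "3.IH"(1)[of zs] "3.prems"(1) subseq_filter[OF ys(2), of "R x"] by simp
    then show ?thesis
      using ys(1) by simp
  qed
qed auto

definition matrix_coloring :: "nat list list \<Rightarrow> nat set \<Rightarrow> nat" where
  "matrix_coloring M e = M ! Min e ! Max e"

definition symmetric_matrix :: "nat \<Rightarrow> 'a list list \<Rightarrow> bool" where
  "symmetric_matrix n M \<longleftrightarrow> length M = n \<and> (\<forall>u<n. length (M ! u) = n) \<and>
     (\<forall>u<n. \<forall>v<n. M ! u ! v = M ! v ! u)"

lemma matrix_coloring_doubleton:
  assumes "symmetric_matrix n M" "u < n" "v < n"
  shows "matrix_coloring M {u, v} = M ! u ! v"
  using assms by (auto simp: matrix_coloring_def symmetric_matrix_def min_def max_def)

lemma edge_coloring_matrix_coloring: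
  assumes "symmetric_matrix n M" "list_all (list_all (\<lambda>x. 1 \<le> x \<and> x \<le> k)) M"
  shows "edge_coloring k n (matrix_coloring M)"
proof -
  have "M ! u ! v \<in> {1..k}" if "u < n" "v < n" for u v
    using assms that by (simp add: symmetric_matrix_def list_all_length)
  with assms(1) show ?thesis
    by (auto simp: edge_coloring_def complete_graph_def nsets_2_eq matrix_coloring_doubleton)
qed

lemma clique_free_imp_no_complete_graph:
  assumes "clique_free (\<lambda>u v. M ! u ! v = i) m [0..<n]"
  shows "\<not> contains_copy (color_class n (matrix_coloring M) i) (complete_graph m)"
proof
  assume "contains_copy (color_class n (matrix_coloring M) i) (complete_graph m)"
  then obtain S where "S \<in> [{..<n}]\<^bsup>m\<^esup>"
    and mono: "\<And>e. e \<in> [S]\<^bsup>2\<^esup> \<Longrightarrow> matrix_coloring M e = i"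
    by (auto simp: contains_copy_color_class_complete_graph_iff monochromatic_def)
  then have S: "S \<subseteq> {..<n}" "finite S" "card S = m"
    by (auto simp: nsets_def)
  have "M ! u ! v = i" if "u \<in> S" "v \<in> S" "u < v" for u v
    using mono[of "{u, v}"] that by (simp add: matrix_coloring_def)
  then have "sorted_wrt (\<lambda>u v. M ! u ! v = i) (sorted_list_of_set S)"
    using S(2) by (intro sorted_wrt_mono_rel[OF _ strict_sorted_list_of_set]) auto
  moreover have "subseq (sorted_list_of_set S) [0..<n]"
    using S(1,2) by (intro sorted_subset_imp_subseq) auto
  ultimately show False
    using clique_free_imp_length_neq[OF assms, of "sorted_list_of_set S"] S(3) by simp
qed

lemma count_list_le_1D:
  assumes "count_list xs z \<le> 1" "a < length xs" "b < length xs" "xs ! a = z" "xs ! b = z"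
  shows "a = b"
proof -
  have "card {j. j < length xs \<and> z = xs ! j} \<le> 1"
    using assms(1) by (simp add: count_list_eq_length_filter length_filter_conv_card)
  then show ?thesis
    using assms(2-) by (auto simp: card_le_Suc0_iff_eq)
qed

definition common_neighbors_le_1 :: "'a \<Rightarrow> 'a list list \<Rightarrow> bool" where
  "common_neighbors_le_1 i M \<longleftrightarrow> sorted_wrt (\<lambda>r s. count_list (zip r s) (i, i) \<le> 1) M"

lemma common_neighbors_le_1_imp_no_cycle_graph_4:
  assumes M: "symmetric_matrix n M" and le_1: "common_neighbors_le_1 i M"
  shows "\<not> contains_copy (color_class n (matrix_coloring M) i) (cycle_graph 4)"
proof
  assume "contains_copy (color_class n (matrix_coloring M) i) (cycle_graph 4)"
  then obtain x y a b where less: "x < n" "y < n" "a < n" "b < n" and neq: "x \<noteq> y" "a \<noteq> b"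
    and entries: "M ! x ! a = i" "M ! x ! b = i" "M ! y ! a = i" "M ! y ! b = i"
    by (rule contains_copy_cycle_graph_4E)
      (auto simp: color_class_def complete_graph_def matrix_coloring_doubleton[OF M])
  have "a = b" if "u < v" "{u, v} = {x, y}" for u v
  proof (rule count_list_le_1D)
    show "count_list (zip (M ! u) (M ! v)) (i, i) \<le> 1"
      using M le_1 that less
      by (auto simp: common_neighbors_le_1_def symmetric_matrix_def sorted_wrt_iff_nth_less
        doubleton_eq_iff)
  qed (use M that less entries in \<open>auto simp: symmetric_matrix_def doubleton_eq_iff\<close>)
  from this[of x y] this[of y x] show False
    using neq by (auto simp: neq_iff insert_commute)
qed

text \<open>The matrix is an argument so that symbolic evaluation normalizes it only once.\<close>

definition avoidance_certificate :: "nat list list \<Rightarrow> bool" where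
  "avoidance_certificate M \<longleftrightarrow> list_all (list_all (\<lambda>x. 1 \<le> x \<and> x \<le> 4)) M \<and>
     clique_free (\<lambda>u v. M ! u ! v = 1) 3 [0..<length M] \<and>
     clique_free (\<lambda>u v. M ! u ! v = 2) 4 [0..<length M] \<and>
     common_neighbors_le_1 3 M \<and> common_neighbors_le_1 4 M"

lemma ramsey_coloring_matrix_coloring:
  assumes M: "symmetric_matrix n M" and cert: "avoidance_certificate M"
  shows "ramsey_coloring [complete_graph 3, complete_graph 4, cycle_graph 4, cycle_graph 4] n
    (matrix_coloring M)"
proof -
  have "length M = n"
    using M by (simp add: symmetric_matrix_def)
  then show ?thesis
    using cert edge_coloring_matrix_coloring[OF M] clique_free_imp_no_complete_graph
      common_neighbors_le_1_imp_no_cycle_graph_4[OF M]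
    by (simp add: ramsey_coloring_def avoidance_certificate_def All_less_Suc eval_nat_numeral)
qed

text \<open>
  Vertex \<open>u\<close> lies in block \<open>u div 6\<close>. Row \<open>k\<close> holds the blocks
  \<open>(k, k), \<dots>, (k, 7)\<close>; a block \<open>(k, l)\<close> lists the colors by the difference modulo 6.
  A part of the blow-up consists of the vertices of one residue modulo 6 in blocks 0 to 3 or
  in blocks 4 to 7. The first entry of a diagonal block colors no edge; its value 2 keeps all
  entries between 1 and 4 and adds no common neighbors in colors 3 and 4.
\<close>

definition color_blocks :: "nat list list list" where
  "color_blocks =
   [
    [[2,2,2,1,2,2], [4,2,2,1,2,2], [4,4,2,1,2,2], [3,3,2,1,2,2],
     [2,3,2,1,1,1], [2,4,2,1,1,1], [3,2,2,1,1,1], [4,2,2,1,1,1]],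
    [[2,2,2,1,2,2], [4,3,2,1,2,2], [4,4,2,1,2,2], [2,3,2,1,1,1],
     [2,3,2,1,1,1], [4,2,2,1,1,1], [3,2,2,1,1,1]],
    [[2,3,2,1,2,3], [3,2,2,1,2,2], [2,2,3,1,1,1], [2,2,4,1,1,1],
     [2,4,2,1,1,1], [2,2,2,1,1,1]],
    [[2,2,4,1,4,2], [2,2,4,1,1,1], [2,2,3,1,1,1], [2,3,2,1,1,1],
     [2,4,2,1,1,1]],
    [[2,2,2,1,2,2], [4,2,2,1,2,2], [4,4,2,1,2,2], [4,3,2,1,2,2]],
    [[2,2,2,1,2,2], [3,3,2,1,2,2], [4,4,2,1,2,2]],
    [[2,2,4,1,4,2], [3,2,2,1,2,2]],
    [[2,3,2,1,2,3]]]"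

definition pair_color :: "nat \<Rightarrow> nat \<Rightarrow> nat" where
  "pair_color u v =
     color_blocks ! (min u v div 6) ! (max u v div 6 - min u v div 6) ! ((max u v - min u v) mod 6)"

definition color_matrix :: "nat list list" where
  "color_matrix = map (\<lambda>u. map (pair_color u) [0..<48]) [0..<48]"

lemma symmetric_matrix_color_matrix: "symmetric_matrix 48 color_matrix"
  by (simp add: symmetric_matrix_def color_matrix_def pair_color_def min.commute max.commute)

lemma avoidance_certificate_color_matrix: "avoidance_certificate color_matrix"
  by code_simp

theorem theorem2:
  shows "ramsey_number [complete_graph 3, complete_graph 4, cycle_graph 4, cycle_graph 4] \<ge> 49 \<and>
    (\<exists>c. edge_coloring 4 48 c \<and>
         \<not> contains_copy (color_class 48 c 1) (complete_graph 3) \<and>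
         \<not> contains_copy (color_class 48 c 2) (complete_graph 4) \<and>
         \<not> contains_copy (color_class 48 c 3) (cycle_graph 4) \<and>
         \<not> contains_copy (color_class 48 c 4) (cycle_graph 4))"
proof -
  let ?Gs = "[complete_graph 3, complete_graph 4, cycle_graph 4, cycle_graph 4]"
  have coloring: "ramsey_coloring ?Gs 48 (matrix_coloring color_matrix)"
    using symmetric_matrix_color_matrix avoidance_certificate_color_matrix
    by (rule ramsey_coloring_matrix_coloring)
  have "finite_simple_graph G" if "G \<in> set ?Gs" for G
    using that finite_simple_graph_complete_graph finite_simple_graph_cycle_graph[of 4] by auto
  then have "48 < ramsey_number ?Gs"
    using coloring less_ramsey_number_iff by blast
  moreover from coloring have "edge_coloring 4 48 (matrix_coloring color_matrix)"
    "\<forall>i<4. \<not> contains_copy (color_class 48 (matrix_coloring color_matrix) (Suc i)) (?Gs ! i)"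
    by (simp_all add: ramsey_coloring_def eval_nat_numeral)
  ultimately show ?thesis
    by (auto simp: eval_nat_numeral All_less_Suc)
qed

end
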